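(* Let $\mathbb{Z}_2=\mathbb{Z}/2\mathbb{Z}$, and let $\tilde X=\mathbb{Z}_2\times\mathbb{Z}_2\times\mathbb{R}$ and $X=\mathbb{Z}_2\times\mathbb{Z}_2\times(\mathbb{R}/\mathbb{Z})$ as manifolds. Let $\pi:\tilde X\to X$ be the natural projection induced by the natural map $\mathbb{R}\to\mathbb{R}/\mathbb{Z}$, i.e. $\pi(a,b,t)=(a,b,t+\mathbb{Z})$. Let $X$ be endowed with the group structure $$(a,b,v)\cdot(c,d,w)=\left(a+c,\;b+d,\;v+w+\tfrac{1}{2}(ad)\right)$$ for $a,b,c,d\in\mathbb{Z}_2$ and $v,w\in\mathbb{R}/\mathbb{Z}$. Then there does not exist any Lie group structure on the manifold $\tilde X$ for which $\pi$ is a group homomorphism.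
   Context: $\mathbb{Z}_2=\mathbb{Z}/2\mathbb{Z}$ carries the discrete topology, so $\tilde X$ is a disjoint union of four copies of $\mathbb{R}$ and $X$ is a disjoint union of four copies of the circle $\mathbb{R}/\mathbb{Z}$, with their standard manifold structures. Lie groups are not required to be connected. In the formula for the group law, $ad$ denotes the product in the ring $\mathbb{Z}/2\mathbb{Z}$, and $\tfrac12(\cdot)$ denotes the well-defined homomorphism $\mathbb{Z}/2\mathbb{Z}\to\mathbb{R}/\mathbb{Z}$ sending the class of $n$ to $\tfrac{n}{2}+\mathbb{Z}$. A Lie group structure on the manifold $\tilde X$ means a group structure on the underlying set which makes $\tilde X$, with its given manifold structure, a Lie group. *)

theory Defs
  imports "HOL-Analysis.Analysis" "HOL-Algebra.Group" "HOL-Library.Z2"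
begin

section \<open>Smooth manifolds and Lie groups\<close>

text \<open>
  \<open>Ck_on k S f\<close> is meant for open \<open>S\<close>: all iterated directional derivatives of
  \<open>f\<close> of order at most \<open>k\<close> exist on \<open>S\<close> (as Frechet derivatives) and are continuous there.
\<close>

primrec Ck_on :: "nat \<Rightarrow> 'a set \<Rightarrow> ('a::real_normed_vector \<Rightarrow> 'b::real_normed_vector) \<Rightarrow> bool" where
  "Ck_on 0 S f \<longleftrightarrow> continuous_on S f"
| "Ck_on (Suc k) S f \<longleftrightarrow>
     (\<forall>x\<in>S. f differentiable (at x)) \<and> (\<forall>v. Ck_on k S (\<lambda>x. frechet_derivative f (at x) v))"

definition smooth_on :: "'a set \<Rightarrow> ('a::real_normed_vector \<Rightarrow> 'b::real_normed_vector) \<Rightarrow> bool" where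
  "smooth_on S f \<longleftrightarrow> (\<forall>k. Ck_on k S f)"

text \<open>
  A chart is a pair of a domain and a coordinate map.  A manifold is a topological space (the
  underlying type) with a smooth atlas; the atlas need not be maximal.
\<close>

type_synonym ('a, 'e) chart = "'a set \<times> ('a \<Rightarrow> 'e)"

definition is_chart ::
  "('a::topological_space, 'e::euclidean_space) chart \<Rightarrow> bool" where
  "is_chart = (\<lambda>(U, \<phi>). open U \<and> open (\<phi> ` U) \<and> (\<exists>\<psi>. homeomorphism U (\<phi> ` U) \<phi> \<psi>))"

definition smooth_manifold ::
  "('a::{t2_space, second_countable_topology}, 'e::euclidean_space) chart set \<Rightarrow> bool" where
  "smooth_manifold A \<longleftrightarrow>
     (\<forall>c\<in>A. is_chart c) \<and> (\<Union>(U, \<phi>)\<in>A. U) = UNIV \<and>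
     (\<forall>(U, \<phi>)\<in>A. \<forall>(V, \<psi>)\<in>A. smooth_on (\<phi> ` (U \<inter> V)) (\<psi> \<circ> inv_into U \<phi>))"

definition smooth_map ::
  "('a::topological_space, 'e::euclidean_space) chart set \<Rightarrow>
   ('b::topological_space, 'f::euclidean_space) chart set \<Rightarrow> ('a \<Rightarrow> 'b) \<Rightarrow> bool" where
  "smooth_map A B f \<longleftrightarrow>
     continuous_on UNIV f \<and>
     (\<forall>(U, \<phi>)\<in>A. \<forall>(V, \<psi>)\<in>B. smooth_on (\<phi> ` (U \<inter> f -` V)) (\<psi> \<circ> f \<circ> inv_into U \<phi>))"

definition prod_atlas ::
  "('a, 'e) chart set \<Rightarrow> ('b, 'f) chart set \<Rightarrow> ('a \<times> 'b, 'e \<times> 'f) chart set" where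
  "prod_atlas A B = (\<lambda>((U, \<phi>), (V, \<psi>)). (U \<times> V, map_prod \<phi> \<psi>)) ` (A \<times> B)"

definition lie_group ::
  "('a::{t2_space, second_countable_topology}, 'e::euclidean_space) chart set \<Rightarrow>
   'a monoid \<Rightarrow> bool" where
  "lie_group A G \<longleftrightarrow>
     smooth_manifold A \<and> group G \<and> carrier G = UNIV \<and>
     smooth_map (prod_atlas A A) A (\<lambda>(x, y). x \<otimes>\<^bsub>G\<^esub> y) \<and>
     smooth_map A A (m_inv G)"


section \<open>The manifold \<open>\<int>/2 \<times> \<int>/2 \<times> \<real>\<close>\<close>

text \<open>The field \<open>\<int>/2\<int>\<close> is the library type \<^typ>\<open>bit\<close>, which we give the discrete topology.\<close>

instantiation bit :: discrete_topology
begin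

definition open_bit :: "bit set \<Rightarrow> bool" where
  "open_bit S \<longleftrightarrow> True"

instance
  by standard (simp_all add: open_bit_def)

end

lemma UNIV_bit: "(UNIV :: bit set) = {0, 1}"
  by auto

instance bit :: second_countable_topology
proof
  have "countable (UNIV :: bit set set)"
    by (simp add: UNIV_bit countable_finite flip: Pow_UNIV)
  moreover have "open = generate_topology (UNIV :: bit set set)"
    by (auto simp: fun_eq_iff open_bit_def intro: generate_topology.Basis)
  ultimately show "\<exists>B :: bit set set. countable B \<and> open = generate_topology B"
    by blast
qed

type_synonym Xt = "bit \<times> bit \<times> real"

definition Xt_atlas :: "(Xt, real) chart set" where
  "Xt_atlas = {({a} \<times> {b} \<times> UNIV, \<lambda>(_, _, t). t) | a b. True}"

lemma Ck_on_const: "Ck_on k S (\<lambda>x. c)"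
  by (induction k arbitrary: c) (simp_all add: frechet_derivative_const)

lemma Ck_on_cong:
  assumes "open S" "Ck_on k S f" "\<And>x. x \<in> S \<Longrightarrow> f x = g x"
  shows "Ck_on k S g"
  using assms(2,3)
proof (induction k arbitrary: f g)
  case 0
  then show ?case using continuous_on_cong by force
next
  case (Suc k)
  have der: "(g has_derivative frechet_derivative f (at x)) (at x)" if "x \<in> S" for x
    using Suc.prems that assms(1)
    by (metis Ck_on.simps(2) frechet_derivative_works has_derivative_transform_within_open)
  then have "frechet_derivative f (at x) = frechet_derivative g (at x)" if "x \<in> S" for x
    using that frechet_derivative_at by blast
  moreover have "\<forall>x\<in>S. g differentiable (at x)"
    using der differentiable_def by blast
  ultimately show ?case
    using Suc.prems(1) Suc.IH by (metis (no_types, lifting) Ck_on.simps(2))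
qed

lemma smooth_on_bounded_linear:
  assumes "bounded_linear f"
  shows "smooth_on S f"
proof -
  have "Ck_on k S f" for k
  proof (cases k)
    case 0
    then show ?thesis using assms by (simp add: linear_continuous_on)
  next
    case (Suc n)
    have "frechet_derivative f (at x) = f" for x
      using assms bounded_linear_imp_has_derivative frechet_derivative_at by metis
    then show ?thesis
      using Suc assms bounded_linear_imp_differentiable by (auto simp: Ck_on_const)
  qed
  then show ?thesis by (simp add: smooth_on_def)
qed

lemma smooth_on_cong:
  assumes "open S" "smooth_on S f" "\<And>x. x \<in> S \<Longrightarrow> f x = g x"
  shows "smooth_on S g"
  using assms Ck_on_cong unfolding smooth_on_def by blast

lemma smooth_on_empty: "smooth_on {} f"
proof -
  have "Ck_on k {} f" for k
    by (induction k arbitrary: f) auto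
  then show ?thesis by (simp add: smooth_on_def)
qed

lemma Xt_chart_image: "(\<lambda>(_, _, t). t) ` ({a} \<times> {b} \<times> (UNIV::real set)) = UNIV"
  by force

lemma Xt_chart_inv:
  "inv_into ({a} \<times> {b} \<times> UNIV) (\<lambda>(_, _, t). t) = (\<lambda>t::real. (a, b, t))"
  by (rule ext, rule inv_into_f_eq) (auto simp: inj_on_def)

lemma smooth_manifold_Xt_atlas: "smooth_manifold Xt_atlas"
  unfolding smooth_manifold_def
proof (intro conjI)
  have "homeomorphism ({a} \<times> {b} \<times> UNIV) UNIV (\<lambda>(_, _, t). t) (\<lambda>t::real. (a, b, t))" for a b :: bit
    by (rule homeomorphismI) (auto simp: case_prod_unfold intro!: continuous_intros)
  moreover have "open ({a} \<times> {b} \<times> (UNIV::real set))" for a b :: bit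
    by (simp add: open_Times open_discrete)
  ultimately have "is_chart ({a} \<times> {b} \<times> UNIV, \<lambda>(_, _, t::real). t)" for a b :: bit
    unfolding is_chart_def by (auto simp: Xt_chart_image simp del: UNIV_Times_UNIV)
  then show "\<forall>c\<in>Xt_atlas. is_chart c"
    by (auto simp: Xt_atlas_def)
next
  have "x \<in> (\<Union>(U, \<phi>)\<in>Xt_atlas. U)" for x
  proof -
    obtain a b t where "x = (a, b, t)" by (cases x)
    moreover have "({a} \<times> {b} \<times> UNIV, \<lambda>(_, _, t). t) \<in> Xt_atlas"
      by (auto simp: Xt_atlas_def)
    ultimately show ?thesis
      using UN_I[of "({a} \<times> {b} \<times> UNIV, \<lambda>(_, _, t). t)" Xt_atlas x "\<lambda>(U, \<phi>). U"] by simp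
  qed
  then show "(\<Union>(U, \<phi>)\<in>Xt_atlas. U) = UNIV"
    by blast
next
  have "smooth_on ((\<lambda>(_, _, t). t) ` (({a} \<times> {b} \<times> UNIV) \<inter> ({c} \<times> {d} \<times> UNIV)))
          ((\<lambda>(_, _, t). t) \<circ> inv_into ({a} \<times> {b} \<times> UNIV) (\<lambda>(_, _, t::real). t))"
    for a b c d :: bit
    unfolding Xt_chart_inv
    using smooth_on_bounded_linear[OF bounded_linear_ident] by (simp add: o_def)
  then show "\<forall>(U, \<phi>)\<in>Xt_atlas. \<forall>(V, \<psi>)\<in>Xt_atlas.
      smooth_on (\<phi> ` (U \<inter> V)) (\<psi> \<circ> inv_into U \<phi>)"
    by (auto simp: Xt_atlas_def simp del: UNIV_Times_UNIV)
qed


section \<open>The group \<open>\<int>/2 \<times> \<int>/2 \<times> \<real>/\<int>\<close>\<close>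

quotient_type rmodz = real / "\<lambda>x y :: real. x - y \<in> \<int>"
  morphisms rep_rmodz to_rmodz
proof (rule equivpI)
  show "reflp (\<lambda>x y :: real. x - y \<in> \<int>)"
    by (simp add: reflp_def)
  show "symp (\<lambda>x y :: real. x - y \<in> \<int>)"
  proof (rule sympI)
    fix x y :: real
    assume "x - y \<in> \<int>"
    from Ints_minus[OF this] show "y - x \<in> \<int>" by simp
  qed
  show "transp (\<lambda>x y :: real. x - y \<in> \<int>)"
  proof (rule transpI)
    fix x y z :: real
    assume "x - y \<in> \<int>" "y - z \<in> \<int>"
    from Ints_add[OF this] show "x - z \<in> \<int>" by simp
  qed
qed

instantiation rmodz :: ab_group_add
begin

lift_definition zero_rmodz :: rmodz is 0 .

lift_definition plus_rmodz :: "rmodz \<Rightarrow> rmodz \<Rightarrow> rmodz" is "(+)"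
proof -
  fix a b c d :: real
  assume "a - b \<in> \<int>" "c - d \<in> \<int>"
  from Ints_add[OF this] show "(a + c) - (b + d) \<in> \<int>"
    by (simp only: add_diff_add)
qed

lift_definition uminus_rmodz :: "rmodz \<Rightarrow> rmodz" is uminus
proof -
  fix a b :: real
  assume "a - b \<in> \<int>"
  from Ints_minus[OF this] show "- a - - b \<in> \<int>" by simp
qed

lift_definition minus_rmodz :: "rmodz \<Rightarrow> rmodz \<Rightarrow> rmodz" is "(-)"
proof -
  fix a b c d :: real
  assume "a - b \<in> \<int>" "c - d \<in> \<int>"
  from Ints_diff[OF this] show "(a - c) - (b - d) \<in> \<int>"
    by (simp add: algebra_simps)
qed

instance
proof
  fix a b c :: rmodz
  show "a + b + c = a + (b + c)" by transfer (simp add: add.assoc)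
  show "a + b = b + a" by transfer (simp add: add.commute)
  show "0 + a = a" by transfer simp
  show "- a + a = 0" by transfer simp
  show "a - b = a + - b" by transfer simp
qed

end

text \<open>
  \<^term>\<open>of_bit\<close> picks the representative 0 or 1; lemma \<open>half_of_int\<close> shows that
  \<open>half\<close> sends the class of any integer \<open>n\<close> to the class of \<open>n/2\<close>.
\<close>

definition half :: "bit \<Rightarrow> rmodz" where
  "half a = to_rmodz (of_bit a / 2)"

lemma half_of_int: "half (of_int n) = to_rmodz (of_int n / 2)"
proof (cases "even n")
  case True
  then obtain m where "n = 2 * m" by auto
  then show ?thesis by (simp add: half_def rmodz.abs_eq_iff)
next
  case False
  then obtain m where m: "n = 2 * m + 1" by (auto elim: oddE)
  then have "(of_int n :: bit) = 1" by simp
  moreover have "1 / 2 - (of_int n / 2 :: real) = of_int (- m)"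
    by (simp add: m field_simps)
  ultimately show ?thesis
    by (auto simp: half_def rmodz.abs_eq_iff)
qed

lemma half_0 [simp]: "half 0 = 0"
  by (simp add: half_def zero_rmodz.abs_eq)

lemma half_add: "half (a + b) = half a + half b"
proof -
  have "half 1 + half 1 = 0"
    by (simp add: half_def plus_rmodz.abs_eq zero_rmodz.abs_eq rmodz.abs_eq_iff)
  then show ?thesis
    by (cases a; cases b) simp_all
qed

definition X_group :: "(bit \<times> bit \<times> rmodz) monoid" where
  "X_group = \<lparr>carrier = UNIV,
     mult = (\<lambda>(a, b, v) (c, d, w). (a + c, b + d, v + w + half (a * d))),
     one = (0, 0, 0)\<rparr>"

lemma X_mult: "(a, b, v) \<otimes>\<^bsub>X_group\<^esub> (c, d, w) = (a + c, b + d, v + w + half (a * d))"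
  by (simp only: X_group_def monoid.simps prod.case)

lemma group_X_group: "group X_group"
proof (rule groupI)
  fix x y z assume "x \<in> carrier X_group" "y \<in> carrier X_group" "z \<in> carrier X_group"
  obtain a b u c d v e f w where xyz: "x = (a, b, u)" "y = (c, d, v)" "z = (e, f, w)"
    by (metis prod_cases3)
  have "half ((a + c) * f) = half (a * f) + half (c * f)"
    and "half (a * (d + f)) = half (a * d) + half (a * f)"
    by (simp_all only: half_add distrib_left distrib_right)
  then show "x \<otimes>\<^bsub>X_group\<^esub> y \<otimes>\<^bsub>X_group\<^esub> z = x \<otimes>\<^bsub>X_group\<^esub> (y \<otimes>\<^bsub>X_group\<^esub> z)"
    by (simp only: xyz X_mult prod.inject ac_simps simp_thms)
next
  fix x assume "x \<in> carrier X_group"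
  obtain a b v where x: "x = (a, b, v)" by (cases x)
  have "(- a, - b, - v - half (- a * b)) \<otimes>\<^bsub>X_group\<^esub> x = (0, 0, 0)"
    unfolding x X_mult by (simp only: left_minus prod.inject simp_thms) simp
  then have "(- a, - b, - v - half (- a * b)) \<otimes>\<^bsub>X_group\<^esub> x = \<one>\<^bsub>X_group\<^esub>"
    by (simp only: X_group_def monoid.simps)
  then show "\<exists>y\<in>carrier X_group. y \<otimes>\<^bsub>X_group\<^esub> x = \<one>\<^bsub>X_group\<^esub>"
    by (rule bexI) (simp add: X_group_def)
next
  fix x
  show "\<one>\<^bsub>X_group\<^esub> \<otimes>\<^bsub>X_group\<^esub> x = x"
    by (cases x) (simp add: X_group_def)
qed (simp_all add: X_group_def)

definition X_proj :: "Xt \<Rightarrow> bit \<times> bit \<times> rmodz" where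
  "X_proj = (\<lambda>(a, b, t). (a, b, to_rmodz t))"

end

(* Both s \<mapsto> (0,0,s) * g and s \<mapsto> g * (0,0,s) lift, through the covering of R/Z by R, the same
   translation of a circle, and they agree at the identity; so the subgroup of all (0,0,s), the
   identity component, is central.  Let x and y lie over (1,0,0) and (0,1,0).  Then xy = z(yx) with z
   in the identity component, and z\<^sup>2 = 1 because x\<^sup>2 is central.  The only such z is 1, whereas the
   commutator of (1,0,0) and (0,1,0) in X is (0,0,1/2). *)

theory Submission
  imports Defs
begin

text \<open>The deviation of \<open>f\<close> from the translation by \<open>c\<close> is continuous
  and integer-valued. Distinct integers are at least 1 apart, so it is constant on the connected
  line.\<close>

lemma continuous_lift_of_translation:
  fixes f :: "real \<Rightarrow> real"
  assumes "continuous_on UNIV f" "\<And>t. f t - (t + c) \<in> \<int>"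
  shows "f t = f s + (t - s)"
proof -
  define g where "g t = f t - (t + c)" for t
  have cont: "continuous_on UNIV g"
    unfolding g_def by (intro continuous_intros assms)
  have "1 \<le> norm (g y - g x)" if "g y \<noteq> g x" for x y
  proof -
    have "g y - g x \<in> \<int>"
      unfolding g_def by (intro Ints_diff assms(2))
    then show ?thesis
      using that by (simp add: Ints_nonzero_abs_ge1)
  qed
  then have "g constant_on UNIV"
    by (intro continuous_discrete_range_constant[OF connected_UNIV cont]) (use zero_less_one in blast)
  then have "g t = g s"
    by (auto simp: constant_on_def)
  then show ?thesis
    by (simp add: g_def)
qed

text \<open>\<open>X_proj\<close> keeps both discrete coordinates, so only the real one has to be
  lifted; its value at \<open>s\<^sub>0\<close> selects one lift among those differing by
  integers.\<close>

lemma lift_of_circle_translation: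
  fixes h :: "real \<Rightarrow> Xt"
  assumes cont: "continuous_on UNIV h"
    and proj: "\<And>s. X_proj (h s) = (c, d, to_rmodz (t + s))"
    and h0: "h s\<^sub>0 = (c, d, t)"
  shows "h s = (c, d, t + s - s\<^sub>0)"
proof -
  define f where "f s = snd (snd (h s))" for s
  have hf: "h s = (c, d, f s)" and lift: "to_rmodz (f s) = to_rmodz (t + s)" for s
    using proj[of s] by (cases "h s"; simp add: f_def X_proj_def)+
  have "f s - (s + t) \<in> \<int>" for s
    using lift[of s] by (simp only: rmodz.abs_eq_iff add.commute)
  moreover have "continuous_on UNIV f"
    unfolding f_def by (intro continuous_intros cont)
  ultimately have "f s = f s\<^sub>0 + (s - s\<^sub>0)"
    using continuous_lift_of_translation by blast
  moreover have "f s\<^sub>0 = t"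
    using h0 by (simp add: f_def)
  ultimately show ?thesis
    using hf[of s] by (simp only: add_diff_eq)
qed

locale group_over_X =
  fixes G :: "Xt monoid" (structure)
  assumes group: "group G"
    and carrier: "carrier G = UNIV"
    and cont: "continuous_on UNIV (\<lambda>(x, y). x \<otimes> y)"
    and hom: "X_proj \<in> hom G X_group"
begin

sublocale group G
  by (fact group)

lemma mem_carrier [simp]: "x \<in> carrier G"
  by (simp add: carrier)

lemma X_proj_mult: "X_proj (x \<otimes> y) = X_proj x \<otimes>\<^bsub>X_group\<^esub> X_proj y"
  using hom by (simp add: hom_def)

text \<open>\<open>X_proj\<close> loses only integer shifts of the real coordinate, so the law of
  \<open>X_group\<close> determines a product in \<open>G\<close> up to such a shift.\<close>

lemma mult_coords:
  obtains u where "(a, b, s) \<otimes> (c, d, t) = (a + c, b + d, u)"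
    and "to_rmodz u = to_rmodz (s + t) + half (a * d)"
proof -
  obtain a' b' u where p: "(a, b, s) \<otimes> (c, d, t) = (a', b', u)"
    by (metis prod_cases3)
  have "(a', b', to_rmodz u) = (a + c, b + d, to_rmodz s + to_rmodz t + half (a * d))"
    using X_proj_mult[of "(a, b, s)" "(c, d, t)"]
    by (simp only: p X_proj_def prod.case X_mult)
  then show thesis
    using p that by (simp only: prod.inject plus_rmodz.abs_eq)
qed

text \<open>The homomorphism property forces this number to be an integer, but not to be 0.\<close>

definition unit_coord :: real where
  "unit_coord = snd (snd \<one>)"

lemma one_coords: "\<one> = (0, 0, unit_coord)"
proof -
  obtain a b t where one: "\<one> = (a, b, t)"
    by (metis prod_cases3)
  obtain u where "(a, b, t) \<otimes> (a, b, t) = (a + a, b + b, u)"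
    using mult_coords by blast
  \<comment> \<open>The identity is idempotent, and the only idempotent of Z/2 under addition is
    0.\<close>
  then have "(a, b, t) = (a + a, b + b, u)"
    using l_one[of \<one>] by (simp only: one mem_carrier)
  then have "a = 0" "b = 0"
    by simp_all
  then show ?thesis
    by (simp add: unit_coord_def one)
qed

text \<open>The twist \<open>half (a * d)\<close> vanishes because the left factor has first
  coordinate 0, so the product lies over a pure translation. The lift is pinned down at
  \<open>s = unit_coord\<close>, where the left factor is the identity.\<close>

lemma identity_component_mult:
  "(0, 0, s) \<otimes> (c, d, t) = (c, d, t + s - unit_coord)"
proof (rule lift_of_circle_translation)
  have "continuous_on UNIV (\<lambda>s. ((0, 0, s), (c, d, t)))"
    by (intro continuous_intros)
  from continuous_on_compose2[OF cont this]
  show "continuous_on UNIV (\<lambda>s. (0, 0, s) \<otimes> (c, d, t))"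
    by simp
  show "X_proj ((0, 0, s) \<otimes> (c, d, t)) = (c, d, to_rmodz (t + s))" for s
    by (simp only: X_proj_mult) (simp add: X_proj_def X_mult plus_rmodz.abs_eq add.commute)
  show "(0, 0, unit_coord) \<otimes> (c, d, t) = (c, d, t)"
    by (simp flip: one_coords)
qed

text \<open>Here the twist vanishes because the right factor has second coordinate 0.\<close>

lemma mult_identity_component:
  "(c, d, t) \<otimes> (0, 0, s) = (c, d, t + s - unit_coord)"
proof (rule lift_of_circle_translation)
  have "continuous_on UNIV (\<lambda>s. ((c, d, t), (0, 0, s)))"
    by (intro continuous_intros)
  from continuous_on_compose2[OF cont this]
  show "continuous_on UNIV (\<lambda>s. (c, d, t) \<otimes> (0, 0, s))"
    by simp
  show "X_proj ((c, d, t) \<otimes> (0, 0, s)) = (c, d, to_rmodz (t + s))" for s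
    by (simp only: X_proj_mult) (simp add: X_proj_def X_mult plus_rmodz.abs_eq add.commute)
  show "(c, d, t) \<otimes> (0, 0, unit_coord) = (c, d, t)"
    by (simp flip: one_coords)
qed

lemma identity_component_central: "(0, 0, s) \<otimes> g = g \<otimes> (0, 0, s)"
  by (cases g) (simp only: identity_component_mult mult_identity_component)

lemma contradiction: False
proof -
  define x y :: Xt where "x = (1, 0, 0)" and "y = (0, 1, 0)"
  obtain p where p: "x \<otimes> y = (1, 1, p)" "to_rmodz p = to_rmodz 0 + half 1"
    using mult_coords[of 1 0 0 0 1 0] by (auto simp: x_def y_def)
  obtain q where q: "y \<otimes> x = (1, 1, q)" "to_rmodz q = to_rmodz 0"
    using mult_coords[of 0 1 0 1 0 0] by (auto simp: x_def y_def)
  obtain r where r: "x \<otimes> x = (0, 0, r)"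
    using mult_coords[of 1 0 0 1 0 0] by (auto simp: x_def)
  \<comment> \<open>Right multiplication by this element shifts the real coordinate by
    \<open>p - q\<close>, which carries \<open>y \<otimes> x\<close> to
    \<open>x \<otimes> y\<close>.\<close>
  define z :: Xt where "z = (0, 0, p - q + unit_coord)"
  have central: "z \<otimes> g = g \<otimes> z" for g
    unfolding z_def by (rule identity_component_central)
  have xy: "x \<otimes> y = (y \<otimes> x) \<otimes> z"
    by (simp add: p q z_def mult_identity_component)
  \<comment> \<open>Moving \<open>y\<close> leftwards past each of the two copies of
    \<open>x\<close> costs one factor \<open>z\<close>.\<close>
  have "(x \<otimes> x) \<otimes> y = x \<otimes> ((y \<otimes> x) \<otimes> z)"
    by (simp add: m_assoc xy)
  also have "\<dots> = (x \<otimes> y) \<otimes> (x \<otimes> z)"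
    by (simp add: m_assoc)
  also have "\<dots> = (y \<otimes> x) \<otimes> ((z \<otimes> x) \<otimes> z)"
    by (simp add: xy m_assoc)
  also have "\<dots> = (y \<otimes> (x \<otimes> x)) \<otimes> (z \<otimes> z)"
    by (simp add: central[of x] m_assoc)
  also have "y \<otimes> (x \<otimes> x) = (x \<otimes> x) \<otimes> y"
    unfolding r by (rule identity_component_central[symmetric])
  finally have "z \<otimes> z = \<one>"
    by simp
  \<comment> \<open>The real coordinate of \<open>z \<otimes> z\<close> is
    \<open>2 * (p - q) + unit_coord\<close>, and the reals have no 2-torsion.\<close>
  then have "p = q"
    by (simp add: z_def identity_component_mult one_coords)
  then have "half 1 = 0"
    using p(2) q(2) by simp
  then have "1 / 2 \<in> (\<int> :: real set)"
    by (simp add: half_def zero_rmodz.abs_eq rmodz.abs_eq_iff)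
  then show False
    by (auto elim!: Ints_cases simp: field_simps)
qed

end

theorem proposition1:
  shows "\<not> (\<exists>G :: Xt monoid. lie_group Xt_atlas G \<and> X_proj \<in> hom G X_group)"
proof
  assume "\<exists>G :: Xt monoid. lie_group Xt_atlas G \<and> X_proj \<in> hom G X_group"
  then obtain G :: "Xt monoid" where "group_over_X G"
    by (auto simp: lie_group_def smooth_map_def group_over_X_def)
  then show False
    by (rule group_over_X.contradiction)
qed

end
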